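(* Let $n\ge 4$ and let $S=\{x,y,z,w\}$ be a set of four distinct vertices of $D_n$ lying in four pairwise distinct clusters of $D_n$. Then there exist $n-1$ internally disjoint $S$-trees in $D_n$.
   Context: The $n$-dimensional dual cube $D_n$ has vertex set all $(2n-1)$-bit binary strings $u_1u_2\cdots u_{2n-1}$. Two vertices $u,v$ are adjacent iff they differ in exactly one bit position $i$, and moreover: if $1\le i\le n-1$ then $u_{2n-1}=v_{2n-1}=0$; if $n\le i\le 2n-2$ then $u_{2n-1}=v_{2n-1}=1$; (if $i=2n-1$ there is no further condition). A cluster of class $0$ is a set of all vertices with last bit $0$ and a fixed value of the bits in positions $n,\dots,2n-2$; a cluster of class $1$ is a set of all vertices with last bit $1$ and a fixed value of the bits in positions $1,\dots,n-1$. The clusters partition $V(D_n)$. For $S\subseteq V(G)$, an $S$-tree is a subtree of $G$ whose vertex set contains $S$; a family of $S$-trees $T_1,\dots,T_m$ is internally disjoint if the trees are pairwise edge-disjoint and $V(T_i)\cap V(T_j)=S$ for all $i\ne j$. *)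

theory Defs
  imports Main
begin

text \<open>Vertices of the dual cube D_n: bool lists of length 2n-1.
  Paper bit position i (1-based) is list index i-1; True = 1.\<close>

definition dc_vertices :: "nat \<Rightarrow> bool list set" where
  "dc_vertices n = {u. length u = 2*n - 1}"

definition dc_adj :: "nat \<Rightarrow> bool list \<Rightarrow> bool list \<Rightarrow> bool" where
  "dc_adj n u v \<longleftrightarrow> u \<in> dc_vertices n \<and> v \<in> dc_vertices n \<and>
     (\<exists>i < 2*n - 1. u ! i \<noteq> v ! i \<and> (\<forall>j < 2*n - 1. j \<noteq> i \<longrightarrow> u ! j = v ! j) \<and>
        (i < n - 1 \<longrightarrow> \<not> u ! (2*n - 2) \<and> \<not> v ! (2*n - 2)) \<and>
        (n - 1 \<le> i \<and> i < 2*n - 2 \<longrightarrow> u ! (2*n - 2) \<and> v ! (2*n - 2)))"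

definition dc_edges :: "nat \<Rightarrow> bool list set set" where
  "dc_edges n = {{u, v} | u v. dc_adj n u v}"

text \<open>Cluster label: class 0 clusters are determined by the last bit 0 and the bits at
  paper positions n..2n-2 (indices n-1..2n-3); class 1 clusters by the last bit 1 and the
  bits at positions 1..n-1 (indices 0..n-2).\<close>

definition dc_cluster :: "nat \<Rightarrow> bool list \<Rightarrow> bool \<times> bool list" where
  "dc_cluster n u = (u ! (2*n - 2),
     if u ! (2*n - 2) then take (n - 1) u else drop (n - 1) (take (2*n - 2) u))"

definition is_cycle :: "'a set set \<Rightarrow> 'a list \<Rightarrow> bool" where
  "is_cycle E cs \<longleftrightarrow> length cs \<ge> 3 \<and> distinct cs \<and>
     (\<forall>i < length cs. {cs ! i, cs ! ((i + 1) mod length cs)} \<in> E)"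

definition graph_connected :: "'a set \<Rightarrow> 'a set set \<Rightarrow> bool" where
  "graph_connected V E \<longleftrightarrow> V \<noteq> {} \<and>
     (\<forall>u\<in>V. \<forall>v\<in>V. (\<lambda>a b. {a, b} \<in> E)\<^sup>*\<^sup>* u v)"

definition is_tree :: "'a set \<Rightarrow> 'a set set \<Rightarrow> bool" where
  "is_tree V E \<longleftrightarrow> finite V \<and> graph_connected V E \<and> (\<nexists>cs. is_cycle E cs)"

definition dc_S_tree :: "nat \<Rightarrow> bool list set \<Rightarrow> bool list set \<times> bool list set set \<Rightarrow> bool" where
  "dc_S_tree n S T \<longleftrightarrow> fst T \<subseteq> dc_vertices n \<and> snd T \<subseteq> dc_edges n \<and>
     (\<forall>e \<in> snd T. e \<subseteq> fst T) \<and> is_tree (fst T) (snd T) \<and> S \<subseteq> fst T"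

definition internally_disjoint_S_trees ::
  "nat \<Rightarrow> bool list set \<Rightarrow> nat \<Rightarrow> (nat \<Rightarrow> bool list set \<times> bool list set set) \<Rightarrow> bool" where
  "internally_disjoint_S_trees n S m T \<longleftrightarrow>
     (\<forall>i < m. dc_S_tree n S (T i)) \<and>
     (\<forall>i < m. \<forall>j < m. i \<noteq> j \<longrightarrow>
        snd (T i) \<inter> snd (T j) = {} \<and> fst (T i) \<inter> fst (T j) = S)"

end

theory Submission
  imports Defs
begin

text \<open>
  Write \<open>m = n - 1\<close> and a vertex as \<open>a @ b @ [c]\<close> with \<open>a\<close>, \<open>b\<close> of length \<open>m\<close>. Contracting all
  clusters turns the dual cube into a complete bipartite graph. Since \<open>2 ^ m - 4 \<ge> m\<close>, there are
  distinct labels \<open>h 0, \<dots>, h (m - 1)\<close> that differ from the labels of all clusters meeting \<open>S\<close>.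
  The \<open>i\<close>-th tree has as hubs the two clusters labelled \<open>h i\<close>, which are joined by a cross edge;
  a vertex of \<open>S\<close> of class 0 reaches the hub of class 1 by walking inside its own cluster to the
  position \<open>h i\<close> and crossing over, and dually for class 1. Inside a cluster, which is an \<open>m\<close>-dimensional
  hypercube, the \<open>m\<close> walks from the vertex of \<open>S\<close> can be chosen to share only their start: this is
  the fan lemma for the cube and an arbitrary set of \<open>m\<close> targets. It is proved by induction on the
  dimension, splitting the cube along a direction in which no two targets are adjacent; such a
  direction exists by Bondy's theorem.
\<close>

section \<open>Walks inside a set of vertices\<close>

text \<open>A walk is recorded only through a vertex set \<open>P\<close> that confines it.
  Disjointness of paths then becomes disjointness of sets, and a set may be larger than the walk
  inside it.\<close>

inductive reach :: "('a \<Rightarrow> 'a \<Rightarrow> bool) \<Rightarrow> 'a set \<Rightarrow> 'a \<Rightarrow> 'a \<Rightarrow> bool" for R P u where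
  base: "u \<in> P \<Longrightarrow> reach R P u u"
| step: "reach R P u v \<Longrightarrow> R v w \<Longrightarrow> w \<in> P \<Longrightarrow> reach R P u w"

lemma reach_start: "reach R P u v \<Longrightarrow> u \<in> P"
  by (induction rule: reach.induct) auto

lemma reach_end: "reach R P u v \<Longrightarrow> v \<in> P"
  by (induction rule: reach.induct) auto

lemma reach_trans: "reach R P u v \<Longrightarrow> reach R P v w \<Longrightarrow> reach R P u w"
  by (rotate_tac 1, induction rule: reach.induct) (auto intro: reach.step)

lemma reach_mono: "reach R P u v \<Longrightarrow> P \<subseteq> Q \<Longrightarrow> reach R Q u v"
  by (induction rule: reach.induct) (auto intro: reach.intros)

lemma reach_edge: "u \<in> P \<Longrightarrow> v \<in> P \<Longrightarrow> R u v \<Longrightarrow> reach R P u v"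
  by (blast intro: reach.intros)

lemma reach_sym:
  assumes "reach R P u v" "\<And>a b. R a b \<Longrightarrow> R b a"
  shows "reach R P v u"
  using assms(1)
proof (induction rule: reach.induct)
  case base
  then show ?case by (rule reach.base)
next
  case (step v w)
  then show ?case
    by (meson assms(2) reach_edge reach_end reach_trans)
qed

lemma reach_map:
  assumes "reach R P u v" "\<And>a. a \<in> P \<Longrightarrow> f a \<in> Q"
    "\<And>a b. a \<in> P \<Longrightarrow> b \<in> P \<Longrightarrow> R a b \<Longrightarrow> R' (f a) (f b)"
  shows "reach R' Q (f u) (f v)"
  using assms(1)
proof (induction rule: reach.induct)
  case base
  then show ?case by (simp add: assms(2) reach.base)
next
  case (step v w)
  then show ?case
    by (meson assms(2,3) reach.step reach_end)
qed

text \<open>Cuts a walk at its first visit to \<open>X\<close>. The fan lemma uses it to decide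
  which of several competing targets a walk should serve.\<close>

lemma reach_first_hit:
  assumes "reach R P u v" "v \<in> X"
  shows "\<exists>x\<in>X. reach R (P - (X - {x})) u x"
proof -
  \<comment> \<open>The induction needs the alternative that \<open>X\<close> has not been met so
    far; it is ruled out at the end because the walk stops in \<open>X\<close>.\<close>
  have "(\<exists>x\<in>X. reach R (P - (X - {x})) u x) \<or> reach R (P - X) u v"
    using assms(1)
  proof (induction rule: reach.induct)
    case base
    then show ?case by (cases "u \<in> X") (auto intro: reach.base)
  next
    case (step v w)
    show ?case
    proof (cases "\<exists>x\<in>X. reach R (P - (X - {x})) u x")
      case False
      then have *: "reach R (P - X) u v" using step by blast
      show ?thesis
      proof (cases "w \<in> X")
        case True
        have "reach R (P - (X - {w})) u v" by (rule reach_mono[OF *]) auto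
        then have "reach R (P - (X - {w})) u w"
          using step by (auto intro: reach.step)
        then show ?thesis using True by blast
      next
        case False
        then show ?thesis using * step by (auto intro: reach.step)
      qed
    qed simp
  qed
  then show ?thesis using assms(2) reach_end by fastforce
qed

section \<open>Fans in the hypercube\<close>

definition flip :: "nat \<Rightarrow> bool list \<Rightarrow> bool list" where
  "flip i u = u[i := \<not> u ! i]"

definition cube_adj :: "bool list \<Rightarrow> bool list \<Rightarrow> bool" where
  "cube_adj u v \<longleftrightarrow> (\<exists>i<length u. v = flip i u)"

text \<open>The face through \<open>v\<close> with free directions \<open>I\<close>. Faces let an
  induction on dimension keep the length of the lists fixed.\<close>

definition subcube :: "bool list \<Rightarrow> nat set \<Rightarrow> bool list set" where
  "subcube v I = {u. length u = length v \<and> (\<forall>j<length v. j \<notin> I \<longrightarrow> u ! j = v ! j)}"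

lemma length_flip [simp]: "length (flip i u) = length u"
  by (simp add: flip_def)

lemma nth_flip: "j < length u \<Longrightarrow> flip i u ! j = (if j = i then \<not> u ! j else u ! j)"
  by (auto simp: flip_def nth_list_update)

lemma flip_flip [simp]: "flip i (flip i u) = u"
  by (cases "i < length u") (auto simp: flip_def list_update_beyond)

lemma flip_neq: "i < length u \<Longrightarrow> flip i u \<noteq> u"
  by (metis nth_flip)

lemma cube_adj_flip: "i < length u \<Longrightarrow> cube_adj u (flip i u)" "i < length u \<Longrightarrow> cube_adj (flip i u) u"
  unfolding cube_adj_def by (auto intro!: exI[of _ i])

lemma cube_adj_neq: "cube_adj u v \<Longrightarrow> u \<noteq> v"
  by (metis cube_adj_def flip_neq)

lemma self_in_subcube [simp]: "v \<in> subcube v I"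
  by (simp add: subcube_def)

lemma subcube_all: "subcube v {..<length v} = {u. length u = length v}"
  by (auto simp: subcube_def)

lemma subcube_insert:
  assumes "i < length v" "i \<notin> I"
  shows "subcube v (insert i I) = subcube v I \<union> subcube (flip i v) I"
    and "subcube v I \<inter> subcube (flip i v) I = {}"
    and "u \<in> subcube v I \<longleftrightarrow> flip i u \<in> subcube (flip i v) I"
proof -
  have coord: "u \<in> subcube v I \<longleftrightarrow> u \<in> subcube v (insert i I) \<and> u ! i = v ! i"
    "u \<in> subcube (flip i v) I \<longleftrightarrow> u \<in> subcube v (insert i I) \<and> u ! i \<noteq> v ! i" for u
    using assms by (auto simp: subcube_def nth_flip split: if_splits)
  show "subcube v (insert i I) = subcube v I \<union> subcube (flip i v) I"
    "subcube v I \<inter> subcube (flip i v) I = {}"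
    using coord by blast+
  have "flip i u \<in> subcube v (insert i I) \<longleftrightarrow> u \<in> subcube v (insert i I)"
    by (auto simp: subcube_def nth_flip)
  moreover have "flip i u ! i \<noteq> u ! i" if "u \<in> subcube v (insert i I)"
    using that assms by (simp add: subcube_def nth_flip)
  ultimately show "u \<in> subcube v I \<longleftrightarrow> flip i u \<in> subcube (flip i v) I"
    using coord by blast
qed

text \<open>Induction on the free directions: a vertex in the far half is one flip away from the
  near half.\<close>

lemma subcube_connected:
  assumes "finite I" "I \<subseteq> {..<length v}" "u \<in> subcube v I"
  shows "reach cube_adj (subcube v I) v u"
  using assms
proof (induction I arbitrary: u rule: finite_induct)
  case empty
  then have "u = v" by (auto simp: subcube_def intro: nth_equalityI)
  then show ?case by (simp add: reach.base)
next
  case (insert i I)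
  then have i: "i < length v" "i \<notin> I" by auto
  note sub = subcube_insert[OF i]
  have *: "reach cube_adj (subcube v (insert i I)) v u" if "u \<in> subcube v I" for u
    using insert.IH[OF _ that] insert.prems(1) by (auto elim!: reach_mono simp: subcube_def)
  show ?case
  proof (cases "u \<in> subcube v I")
    case False
    then have "u \<in> subcube (flip i v) I" using insert.prems sub(1) by blast
    then have "flip i u \<in> subcube v I" using sub(3)[of "flip i u"] by simp
    moreover have "i < length u" using insert.prems i by (simp add: subcube_def)
    ultimately show ?thesis
      using *[of "flip i u"] cube_adj_flip insert.prems(2) by (blast intro: reach.step)
  qed (rule *)
qed

section \<open>Coordinates that separate a set of targets\<close>

text \<open>Bondy's theorem is the case \<open>card T = k\<close>: some coordinate can be dropped.\<close>

lemma distinguishing_coordinates: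
  assumes "finite T" "T \<noteq> {}" "\<And>t. t \<in> T \<Longrightarrow> length t = k"
  shows "\<exists>D. finite D \<and> card D < card T \<and> (\<forall>s\<in>T. \<forall>t\<in>T. (\<forall>j\<in>D. s ! j = t ! j) \<longrightarrow> s = t)"
  using assms
proof (induction T rule: finite_ne_induct)
  case (singleton x)
  show ?case by (rule exI[of _ "{}"]) auto
next
  case (insert t T)
  then obtain D where D: "finite D" "card D < card T"
    "\<And>r s. r \<in> T \<Longrightarrow> s \<in> T \<Longrightarrow> (\<forall>j\<in>D. r ! j = s ! j) \<Longrightarrow> r = s"
    by (metis insertCI)
  show ?case
  proof (cases "\<exists>s\<in>T. \<forall>j\<in>D. s ! j = t ! j")
    case True
    then obtain s where s: "s \<in> T" "\<forall>j\<in>D. s ! j = t ! j" by blast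
    then have "s \<noteq> t" using insert by blast
    then obtain i where i: "s ! i \<noteq> t ! i"
      using insert.prems s(1) by (metis insertCI nth_equalityI)
    \<comment> \<open>\<open>D\<close> separates \<open>T\<close>, so \<open>s\<close> is the only
      member agreeing with \<open>t\<close> on \<open>D\<close>. One coordinate \<open>i\<close>
      telling \<open>s\<close> from \<open>t\<close> therefore repairs \<open>D\<close>.\<close>
    have uniq: "r = s" if "r \<in> T" "\<forall>j\<in>D. r ! j = t ! j" for r
      using D(3)[of r s] s that by simp
    have "\<forall>r\<in>insert t T. \<forall>s\<in>insert t T. (\<forall>j\<in>insert i D. r ! j = s ! j) \<longrightarrow> r = s"
      using D(3) uniq i by (metis insert_iff)
    moreover have "card (insert i D) < card (insert t T)"
      using D insert by (simp add: card_insert_if)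
    ultimately show ?thesis using D(1) by (intro exI[of _ "insert i D"]) simp
  next
    case False
    then have "\<forall>r\<in>insert t T. \<forall>s\<in>insert t T. (\<forall>j\<in>D. r ! j = s ! j) \<longrightarrow> r = s"
      using D(3) by (metis insert_iff)
    then show ?thesis using D insert by (intro exI[of _ D]) simp
  qed
qed

text \<open>A separating set \<open>D\<close> is smaller than \<open>I\<close>, so some
  \<open>i\<close> in \<open>I\<close> lies outside it. Flipping \<open>i\<close> changes nothing on
  \<open>D\<close>, so \<open>t\<close> and \<open>flip i t\<close> cannot both be targets.\<close>

lemma isolating_direction:
  assumes "finite T" "T \<noteq> {}" "\<And>t. t \<in> T \<Longrightarrow> length t = k" "card T \<le> card I" "I \<subseteq> {..<k}"
  shows "\<exists>i\<in>I. \<forall>t\<in>T. flip i t \<notin> T"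
proof -
  obtain D where D: "finite D" "card D < card T"
    "\<And>r s. r \<in> T \<Longrightarrow> s \<in> T \<Longrightarrow> (\<forall>j\<in>D. r ! j = s ! j) \<Longrightarrow> r = s"
    using distinguishing_coordinates[OF assms(1-3)] by blast
  then have "\<not> I \<subseteq> D" using assms(4) card_mono[of D I] by linarith
  then obtain i where i: "i \<in> I" "i \<notin> D" by blast
  have "flip i t \<notin> T" if "t \<in> T" for t
  proof
    assume "flip i t \<in> T"
    moreover have "\<forall>j\<in>D. flip i t ! j = t ! j" using i by (metis flip_def nth_list_update_neq)
    ultimately have "flip i t = t" using D(3) that by blast
    moreover have "i < length t" using i assms(3,5) that by auto
    ultimately show False using flip_neq by blast
  qed
  then show ?thesis using i by blast
qed

section \<open>The fan lemma for faces of the cube\<close>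

definition fan :: "bool list \<Rightarrow> bool list set \<Rightarrow> bool list set \<Rightarrow> (bool list \<Rightarrow> bool list set) \<Rightarrow> bool" where
  "fan v T C P \<longleftrightarrow> (\<forall>t\<in>T. P t \<subseteq> C \<and> reach cube_adj (P t) v t) \<and>
     (\<forall>s\<in>T. \<forall>t\<in>T. s \<noteq> t \<longrightarrow> P s \<inter> P t \<subseteq> {v})"

text \<open>Induction on the dimension of the face, halved along an isolating direction
  \<open>i\<close>. If the half \<open>H0\<close> of \<open>v\<close> holds all targets, one of them
  is rerouted through \<open>H1\<close>. Otherwise one target \<open>c\<close> in \<open>H1\<close>
  is reached by crossing at \<open>v\<close>, and the other targets in \<open>H1\<close> are
  replaced by their neighbours in \<open>H0\<close>. Either way at most \<open>k\<close> targets
  remain for the induction hypothesis in \<open>H0\<close>.\<close>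

lemma subcube_fan:
  assumes "finite I" "I \<subseteq> {..<length v}" "finite T" "T \<subseteq> subcube v I - {v}" "card T \<le> card I"
  shows "\<exists>P. fan v T (subcube v I) P"
  using assms
proof (induction "card I" arbitrary: I T)
  case 0
  then have "T = {}" by simp
  then show ?case by (simp add: fan_def)
next
  case (Suc k)
  show ?case
  proof (cases "T = {}")
    case True
    then show ?thesis by (auto simp: fan_def)
  next
    case False
    have "\<And>t. t \<in> T \<Longrightarrow> length t = length v" using Suc.prems(4) by (auto simp: subcube_def)
    then obtain i where i: "i \<in> I" and iso: "\<And>t. t \<in> T \<Longrightarrow> flip i t \<notin> T"
      using isolating_direction[of T "length v" I] Suc.prems False by blast
    define J where "J = I - {i}"
    have J: "I = insert i J" "i \<notin> J" "finite J" "J \<subseteq> {..<length v}" "card J = k"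
      using i Suc.prems Suc.hyps(2) by (auto simp: J_def)
    have iv: "i < length v" using i Suc.prems by auto
    define H0 where "H0 = subcube v J"
    define H1 where "H1 = subcube (flip i v) J"
    have cube: "subcube v I = H0 \<union> H1" and disj: "H0 \<inter> H1 = {}"
      and swap: "\<And>u. u \<in> H0 \<longleftrightarrow> flip i u \<in> H1"
      unfolding H0_def H1_def J(1) using subcube_insert[OF iv J(2)] by auto
    have swap': "\<And>u. u \<in> H1 \<longleftrightarrow> flip i u \<in> H0" using swap by (metis flip_flip)
    have v0: "v \<in> H0" by (simp add: H0_def)
    have len: "i < length u" if "u \<in> H0 \<union> H1" for u
      using that iv by (auto simp: H0_def H1_def subcube_def)
    have conn1: "reach cube_adj H1 (flip i v) u" if "u \<in> H1" for u
      using that J unfolding H1_def by (intro subcube_connected) auto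
    have IH: "\<exists>P. fan v T' H0 P" if "finite T'" "T' \<subseteq> H0 - {v}" "card T' \<le> k" for T'
      using Suc.hyps(1)[of J T'] that J unfolding H0_def by blast
    show ?thesis
    proof (cases "T \<subseteq> H0")
      case True
      \<comment> \<open>The half \<open>H1\<close> is free of targets, so one target can be reached through it.\<close>
      have detour: "reach cube_adj ({v, t} \<union> H1) v t" if "t \<in> H0" for t
      proof -
        have "reach cube_adj ({v, t} \<union> H1) (flip i v) (flip i t)"
          using conn1 swap that by (blast intro: reach_mono)
        moreover have "cube_adj v (flip i v)" "cube_adj (flip i t) t"
          using cube_adj_flip len that v0 by blast+
        ultimately show ?thesis
          by (meson UnCI insertCI reach.base reach.step reach_trans reach_edge reach_start)
      qed
      obtain t where t: "t \<in> T" using False by blast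
      have "card (T - {t}) \<le> k" using t Suc.prems(3,5) Suc.hyps(2) by simp
      then obtain P where P: "fan v (T - {t}) H0 P"
        using IH[of "T - {t}"] Suc.prems(3,4) True by blast
      show ?thesis
      \<comment> \<open>The detour meets \<open>H0\<close> only in \<open>v\<close> and
        \<open>t\<close>, so the sole possible conflict is a set \<open>P s\<close> that already
        contains \<open>t\<close>.\<close>
      proof (cases "\<exists>s\<in>T - {t}. t \<in> P s")
        case False
        have "fan v T (subcube v I) (P(t := {v, t} \<union> H1))"
          using P False detour t True disj v0 unfolding fan_def cube by (auto; blast)
        then show ?thesis by blast
      next
        case hit: True
        then obtain s where s: "s \<in> T" "s \<noteq> t" "t \<in> P s" by blast
        have "reach cube_adj (P s) v s" using P s by (auto simp: fan_def)
        \<comment> \<open>Whichever of \<open>s\<close> and \<open>t\<close> is met first, called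
          \<open>a\<close>, keeps the initial piece of this walk; the other one, \<open>b\<close>,
          takes the detour through \<open>H1\<close>.\<close>
        then obtain a where a: "a \<in> {s, t}" "reach cube_adj (P s - ({s, t} - {a})) v a"
          using reach_first_hit[of cube_adj "P s" v s "{s, t}"] by blast
        define b where "b = (if a = s then t else s)"
        have b: "b \<in> {s, t}" "a \<noteq> b" "{s, t} - {a} = {b}" using a s by (auto simp: b_def)
        have vb: "v \<noteq> b" using b(1) s t Suc.prems(4) by auto
        \<comment> \<open>Both \<open>s\<close> and \<open>t\<close> lie in \<open>P s\<close>,
          hence so does \<open>b\<close>, and the sets of the remaining targets cannot contain
          it.\<close>
        have other: "b \<notin> P r" if "r \<in> T" "r \<noteq> s" "r \<noteq> t" for r
        proof
          assume "b \<in> P r"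
          moreover have "b \<in> P s" using b(1) s P reach_end by (fastforce simp: fan_def)
          moreover have "P s \<inter> P r \<subseteq> {v}" using P s that by (simp add: fan_def)
          ultimately have "b = v" by blast
          then show False using vb by simp
        qed
        have "fan v T (subcube v I) (P(a := P s - {b}, b := {v, b} \<union> H1))"
          unfolding fan_def
        proof (intro conjI ballI impI)
          fix r assume r: "r \<in> T"
          have bH: "b \<in> H0" using b(1) s t True by auto
          consider "r = a" "r \<noteq> b" | "r = b" | "r \<noteq> s" "r \<noteq> t" "r \<noteq> a" "r \<noteq> b" using a b by auto
          note cs = this
          have PsH: "P s \<subseteq> H0" using P s by (auto simp: fan_def)
          show "(P(a := P s - {b}, b := {v, b} \<union> H1)) r \<subseteq> subcube v I"
            using cs
          proof cases
            case 3 then show ?thesis using P r cube by (auto simp: fan_def)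
          qed (use PsH cube bH v0 in auto)
          show "reach cube_adj ((P(a := P s - {b}, b := {v, b} \<union> H1)) r) v r"
            using cs
          proof cases
            case 1 then show ?thesis using a(2) b(3) by simp
          next
            case 2 then show ?thesis using detour[OF bH] by simp
          next
            case 3 then show ?thesis using P r by (auto simp: fan_def)
          qed
        next
          fix q r assume qr: "q \<in> T" "r \<in> T" "q \<noteq> r"
          have ab: "{s, t} = {a, b}" using a b by auto
          have in0: "P r \<subseteq> H0" if "r \<in> T" "r \<noteq> t" for r using P that by (auto simp: fan_def)
          have dj: "P q \<inter> P r \<subseteq> {v}" if "q \<in> T" "r \<in> T" "q \<noteq> r" "q \<noteq> t" "r \<noteq> t" for q r
            using P that by (auto simp: fan_def)
          have A: "(P s - {b}) \<inter> P r \<subseteq> {v}" "({v, b} \<union> H1) \<inter> P r \<subseteq> {v}"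
            if "r \<in> T" "r \<noteq> a" "r \<noteq> b" for r
          proof -
            have "r \<noteq> s" "r \<noteq> t" using that ab by blast+
            then show "(P s - {b}) \<inter> P r \<subseteq> {v}" "({v, b} \<union> H1) \<inter> P r \<subseteq> {v}"
              using dj[of s r] other[of r] in0[of r] disj s that by blast+
          qed
          have B: "(P s - {b}) \<inter> ({v, b} \<union> H1) \<subseteq> {v}" using in0[of s] s disj by blast
          have C: "P q \<inter> P r \<subseteq> {v}" if "q \<notin> {a, b}" "r \<notin> {a, b}"
            using that ab dj[of q r] qr by blast
          show "(P(a := P s - {b}, b := {v, b} \<union> H1)) q \<inter> (P(a := P s - {b}, b := {v, b} \<union> H1)) r \<subseteq> {v}"
            using A[of q] A[of r] B C qr b(2) by (auto simp: Int_commute split: if_splits)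
        qed
        then show ?thesis by blast
      qed
    next
      case False
      define T1 where "T1 = T \<inter> H1"
      have "T1 \<noteq> {}" using False Suc.prems(4) cube by (auto simp: T1_def)
      \<comment> \<open>\<open>c\<close> is the first target on a walk in \<open>H1\<close> from
        \<open>flip i v\<close>, so that walk avoids all other targets of \<open>H1\<close>.\<close>
      then obtain c where c: "c \<in> T1" and cr: "reach cube_adj (H1 - (T1 - {c})) (flip i v) c"
        using reach_first_hit conn1 unfolding T1_def by (metis Int_iff equals0I)
      \<comment> \<open>The projection to \<open>H0\<close> of every target except \<open>c\<close>;
        dropping \<open>c\<close> is what brings the number down to \<open>k\<close>.\<close>
      define T' where "T' = (T \<inter> H0) \<union> flip i ` (T1 - {c})"
      have "finite T'" using Suc.prems(3) by (simp add: T'_def T1_def)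
      moreover have "T' \<subseteq> H0 - {v}"
      proof -
        \<comment> \<open>The walk to \<open>c\<close> starts at \<open>flip i v\<close>, which is
          therefore no target other than \<open>c\<close>. So no projected target is
          \<open>v\<close>, as the induction hypothesis demands.\<close>
        have "flip i t \<noteq> v" if "t \<in> T1 - {c}" for t
          using reach_start[OF cr] that by auto
        then show ?thesis using Suc.prems(4) swap' by (auto simp: T'_def T1_def)
      qed
      moreover have "card T' \<le> k"
      proof -
        have "card T' \<le> card (T \<inter> H0) + card (T1 - {c})"
          unfolding T'_def using Suc.prems(3) card_Un_le card_image_le[of "T1 - {c}" "flip i"]
          by (metis (no_types, lifting) T1_def add_left_mono finite_Diff finite_Int order_trans)
        also have "\<dots> = card ((T \<inter> H0) \<union> (T1 - {c}))"
          using Suc.prems(3) disj by (subst card_Un_disjoint) (auto simp: T1_def)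
        also have "\<dots> \<le> card (T - {c})"
          using Suc.prems(3) c disj by (intro card_mono) (auto simp: T1_def)
        also have "\<dots> \<le> k"
          using c Suc.prems(3,5) Suc.hyps(2) by (simp add: T1_def)
        finally show ?thesis .
      qed
      ultimately obtain P where P: "fan v T' H0 P" using IH by blast
      \<comment> \<open>Targets in \<open>H0\<close> keep their sets, \<open>c\<close> gets the walk
        crossing at \<open>v\<close>, and every other target in \<open>H1\<close> is appended to the
        set of its projection. Only these appended vertices and the walk to \<open>c\<close> enter
        \<open>H1\<close>.\<close>
      define P' where "P' t = (if t \<in> H0 then P t else if t = c then insert v (H1 - (T1 - {c}))
        else insert t (P (flip i t)))" for t
      have c1: "c \<in> H1" "c \<in> T" "c \<notin> H0" using c disj by (auto simp: T1_def)
      have other: "flip i t \<in> T'" "t \<in> H1" "t \<in> T1" if "t \<in> T" "t \<notin> H0" "t \<noteq> c" for t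
        using that Suc.prems(4) cube by (auto simp: T'_def T1_def)
      have PT: "P t \<subseteq> H0" "reach cube_adj (P t) v t" if "t \<in> T'" for t
        using P that by (auto simp: fan_def)
      have dj: "P s \<inter> P t \<subseteq> {v}" if "s \<in> T'" "t \<in> T'" "s \<noteq> t" for s t
        using P that by (auto simp: fan_def)
      have T0: "t \<in> T'" if "t \<in> T" "t \<in> H0" for t using that by (auto simp: T'_def)
      have "fan v T (subcube v I) P'"
        unfolding fan_def
      proof (intro conjI ballI impI)
        fix t assume t: "t \<in> T"
        show "P' t \<subseteq> subcube v I"
          using t T0[of t] other[of t] PT v0 unfolding P'_def cube by auto
        consider "t \<in> H0" | "t = c" | "t \<notin> H0" "t \<noteq> c" by blast
        then show "reach cube_adj (P' t) v t"
        proof cases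
          case 1 then show ?thesis using T0 t PT by (simp add: P'_def)
        next
          case 2
          have "reach cube_adj (insert v (H1 - (T1 - {c}))) (flip i v) c"
            using cr by (rule reach_mono) auto
          moreover have "cube_adj v (flip i v)" using cube_adj_flip iv by blast
          ultimately show ?thesis using 2 c1
            by (simp add: P'_def) (meson insertI1 reach_edge reach_start reach_trans)
        next
          case 3
          have "reach cube_adj (insert t (P (flip i t))) v (flip i t)"
            using PT(2)[OF other(1)[OF t 3]] by (rule reach_mono) auto
          moreover have "cube_adj (flip i t) t" using cube_adj_flip len other(2)[OF t 3] by blast
          ultimately show ?thesis using 3 by (auto simp: P'_def intro: reach.step)
        qed
      next
        fix s t assume st: "s \<in> T" "t \<in> T" "s \<noteq> t"
        have 00: "P s \<inter> P t \<subseteq> {v}" if "s \<in> T" "t \<in> T" "s \<noteq> t" "s \<in> H0" "t \<in> H0" for s t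
          using that dj T0 by blast
        have 01: "P s \<inter> insert v (H1 - (T1 - {c})) \<subseteq> {v}" if "s \<in> T" "s \<in> H0" for s
          using PT(1)[OF T0] that disj by blast
        have 02: "P s \<inter> insert t (P (flip i t)) \<subseteq> {v}"
          if "s \<in> T" "s \<in> H0" "t \<in> T" "t \<notin> H0" "t \<noteq> c" for s t
        proof -
          \<comment> \<open>Isolation of \<open>i\<close> enters here: a projected target never
            coincides with a genuine target in \<open>H0\<close>, so the two use different sets of
            the fan.\<close>
          have "s \<noteq> flip i t" using iso that by auto
          then show ?thesis using dj[OF T0 other(1)] PT(1)[OF T0] that disj by blast
        qed
        have 12: "insert v (H1 - (T1 - {c})) \<inter> insert t (P (flip i t)) \<subseteq> {v}"
          if "t \<in> T" "t \<notin> H0" "t \<noteq> c" for t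
          using PT(1)[OF other(1)] other(3) that disj by blast
        have 22: "insert s (P (flip i s)) \<inter> insert t (P (flip i t)) \<subseteq> {v}"
          if "s \<in> T" "s \<notin> H0" "s \<noteq> c" "t \<in> T" "t \<notin> H0" "t \<noteq> c" "s \<noteq> t" for s t
        proof -
          have "flip i s \<noteq> flip i t" using that by (metis flip_flip)
          then have "P (flip i s) \<inter> P (flip i t) \<subseteq> {v}" using dj other(1) that by blast
          moreover have "P (flip i s) \<subseteq> H0" "P (flip i t) \<subseteq> H0" using PT(1) other(1) that by blast+
          ultimately show ?thesis using that by blast
        qed
        consider "s \<in> H0" | "s = c" | "s \<notin> H0" "s \<noteq> c" by blast
        note sc = this
        consider "t \<in> H0" | "t = c" | "t \<notin> H0" "t \<noteq> c" by blast
        note tc = this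
        show "P' s \<inter> P' t \<subseteq> {v}"
          using sc
        proof cases
          case 1
          from tc show ?thesis
            using st 1 c1 00[of s t] 01[of s] 02[of s t] by cases (auto simp: P'_def)
        next
          case 2
          from tc show ?thesis
            using st 2 c1 01[of t] 12[of t] by cases (auto simp: P'_def)
        next
          case 3
          from tc show ?thesis
            using st 3 c1 02[of t s] 12[of s] 22[of s t] by cases (auto simp: P'_def)
        qed
      qed
      then show ?thesis by blast
    qed
  qed
qed

text \<open>The whole cube is the face with all directions free. A target equal to \<open>v\<close>,
  excluded in \<open>subcube_fan\<close>, receives the trivial walk.\<close>

lemma cube_fan:
  assumes "finite T" "T \<subseteq> {u. length u = m}" "card T \<le> m" "length v = m"
  shows "\<exists>P. fan v T {u. length u = m} P"
proof -
  have "card (T - {v}) \<le> m" using assms by (meson card_Diff1_le order_trans)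
  then obtain P where P: "fan v (T - {v}) {u. length u = m} P"
    using subcube_fan[of "{..<m}" v "T - {v}"] subcube_all[of v] assms by auto
  have "fan v T {u. length u = m} (P(v := {v}))"
    using P assms(4) by (auto simp: fan_def intro: reach.base)
  then show ?thesis by blast
qed

text \<open>Chooses fans for all starting points at once, all with targets \<open>h i\<close>, so
  that index \<open>i\<close> can later mean the \<open>i\<close>-th tree in every cluster.\<close>

lemma cube_fan_indexed:
  assumes "inj_on h {..<m}" "\<And>i. i < m \<Longrightarrow> length (h i) = m"
  obtains P where "\<And>v i. length v = m \<Longrightarrow> i < m \<Longrightarrow> P v i \<subseteq> {u. length u = m}"
    "\<And>v i. length v = m \<Longrightarrow> i < m \<Longrightarrow> reach cube_adj (P v i) v (h i)"
    "\<And>v i j. length v = m \<Longrightarrow> i < m \<Longrightarrow> j < m \<Longrightarrow> i \<noteq> j \<Longrightarrow> P v i \<inter> P v j \<subseteq> {v}"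
proof -
  have "\<exists>P. fan v (h ` {..<m}) {u. length u = m} P" if "length v = m" for v
    using that assms card_image_le[of "{..<m}" h] by (intro cube_fan) auto
  then obtain Q where Q: "fan v (h ` {..<m}) {u. length u = m} (Q v)" if "length v = m" for v
    by metis
  show thesis
  proof (rule that[of "\<lambda>v i. Q v (h i)"])
    fix v :: "bool list" and i j assume v: "length v = m" and i: "i < m"
    show "Q v (h i) \<subseteq> {u. length u = m}" "reach cube_adj (Q v (h i)) v (h i)"
      using Q[OF v] i by (auto simp: fan_def)
    assume j: "j < m" "i \<noteq> j"
    then have "h i \<noteq> h j" using i assms(1) by (auto simp: inj_on_def)
    then show "Q v (h i) \<inter> Q v (h j) \<subseteq> {v}"
      using Q[OF v] i j by (auto simp: fan_def)
  qed
qed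

lemma cube_vertices_avoiding:
  assumes "finite F" "card F + m \<le> 2 ^ m"
  obtains h :: "nat \<Rightarrow> bool list"
  where "inj_on h {..<m}" "\<And>i. i < m \<Longrightarrow> length (h i) = m" "\<And>i. i < m \<Longrightarrow> h i \<notin> F"
proof -
  define C where "C = {u :: bool list. length u = m}"
  have C: "finite C" "card C = 2 ^ m"
    using finite_lists_length_eq[of "UNIV :: bool set" m] card_lists_length_eq[of "UNIV :: bool set" m]
    by (auto simp: C_def)
  have "m \<le> card (C - F)" using C assms diff_card_le_card_Diff[of F C] by linarith
  then obtain h where "inj_on h {..<m}" "h ` {..<m} \<subseteq> C - F"
    using card_le_inj[of "{..<m}" "C - F"] C(1) by auto
  then show thesis by (intro that[of h]) (auto simp: C_def)
qed

section \<open>Spanning trees\<close>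

lemma edge_walk_sym: "(\<lambda>a b. {a, b} \<in> E)\<^sup>*\<^sup>* u v \<Longrightarrow> (\<lambda>a b. {a, b} \<in> E)\<^sup>*\<^sup>* v u"
  by (metis (mono_tags, lifting) insert_commute symp_onI symp_rtranclp sympD)

text \<open>The edge closing the cycle is removed; the rest of the cycle is a path that replaces it
  in every walk.\<close>

lemma graph_connected_remove_cycle_edge:
  assumes "graph_connected V E" "is_cycle E cs"
  shows "\<exists>e\<in>E. graph_connected V (E - {e})"
proof -
  let ?k = "length cs"
  let ?e = "{cs ! (?k - 1), cs ! 0}"
  have k: "?k \<ge> 3" and d: "distinct cs"
    and ce: "\<And>i. i < ?k \<Longrightarrow> {cs ! i, cs ! ((i + 1) mod ?k)} \<in> E"
    using assms(2) by (auto simp: is_cycle_def)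
  have "?k - 1 + 1 = ?k" using k by linarith
  then have e: "?e \<in> E" using ce[of "?k - 1"] k by (simp del: One_nat_def)
  have path: "(\<lambda>a b. {a, b} \<in> E - {?e})\<^sup>*\<^sup>* (cs ! 0) (cs ! j)" if "j < ?k" for j
    using that
  proof (induction j)
    case (Suc j)
    have "{cs ! j, cs ! Suc j} \<in> E" using ce[of j] Suc.prems by simp
    \<comment> \<open>With at least three vertices, no other consecutive pair forms the closing
      edge; with two vertices this would fail.\<close>
    moreover have "{cs ! j, cs ! Suc j} \<noteq> ?e"
    proof
      assume "{cs ! j, cs ! Suc j} = ?e"
      then have "cs ! j = cs ! (?k - 1) \<or> cs ! j = cs ! 0 \<and> cs ! Suc j = cs ! (?k - 1)"
        by (auto simp: doubleton_eq_iff)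
      moreover have "?k - 1 < ?k" "0 < ?k" "j < ?k" using k Suc.prems by auto
      ultimately have "j = ?k - 1 \<or> j = 0 \<and> Suc j = ?k - 1"
        using d Suc.prems by (auto simp: nth_eq_iff_index_eq simp del: One_nat_def)
      then show False using Suc.prems k by auto
    qed
    ultimately have "{cs ! j, cs ! Suc j} \<in> E - {?e}" by simp
    then show ?case using Suc by (simp add: rtranclp.rtrancl_into_rtrancl)
  qed simp
  have ends: "(\<lambda>a b. {a, b} \<in> E - {?e})\<^sup>*\<^sup>* (cs ! 0) (cs ! (?k - 1))" using path k by simp
  have "(\<lambda>a b. {a, b} \<in> E - {?e})\<^sup>*\<^sup>* u v" if "(\<lambda>a b. {a, b} \<in> E)\<^sup>*\<^sup>* u v" for u v
    using that
  proof induction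
    case (step a b)
    have "(\<lambda>a b. {a, b} \<in> E - {?e})\<^sup>*\<^sup>* a b"
    proof (cases "{a, b} = ?e")
      case True
      then show ?thesis using ends edge_walk_sym[OF ends] by (auto simp: doubleton_eq_iff)
    next
      case False
      then show ?thesis using step by (intro r_into_rtranclp) simp
    qed
    then show ?case using step.IH by simp
  qed simp
  then have "graph_connected V (E - {?e})"
    using assms(1) unfolding graph_connected_def by blast
  then show ?thesis using e by blast
qed

text \<open>A connected edge set of least size has no cycle, since an edge of a cycle could be
  removed.\<close>

lemma spanning_tree_exists:
  assumes "finite V" "finite E" "graph_connected V E"
  shows "\<exists>E'\<subseteq>E. is_tree V E'"
proof -
  obtain E' where E': "E' \<subseteq> E" "graph_connected V E'"
    and least: "\<And>F. F \<subseteq> E \<Longrightarrow> graph_connected V F \<Longrightarrow> card E' \<le> card F"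
    using ex_has_least_nat[of "\<lambda>F. F \<subseteq> E \<and> graph_connected V F" E card] assms(3) by blast
  have "\<not> is_cycle E' cs" for cs
  proof
    assume "is_cycle E' cs"
    then obtain e where e: "e \<in> E'" "graph_connected V (E' - {e})"
      using graph_connected_remove_cycle_edge E'(2) by blast
    have "finite E'" using E'(1) assms(2) finite_subset by blast
    then have "card (E' - {e}) < card E'" using e(1) by (rule card_Diff1_less)
    moreover have "card E' \<le> card (E' - {e})" using least[of "E' - {e}"] e(2) E'(1) by blast
    ultimately show False by simp
  qed
  then show ?thesis using E' assms(1) by (auto simp: is_tree_def)
qed

section \<open>The dual cube\<close>

lemma finite_dc_vertices: "finite (dc_vertices n)"
  using finite_lists_length_eq[of "UNIV :: bool set" "2 * n - 1"] by (simp add: dc_vertices_def)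

lemma dc_adj_sym: "dc_adj n u v \<Longrightarrow> dc_adj n v u"
  unfolding dc_adj_def by (elim conjE exE, intro conjI exI) auto

text \<open>\<open>V\<close> itself may be disconnected, so a spanning tree is taken of the part
  \<open>W\<close> reachable from \<open>r\<close>. The relation \<open>R\<close> is a parameter so
  that selected edges can be forbidden.\<close>

lemma S_tree_within:
  assumes V: "V \<subseteq> dc_vertices n" and r: "r \<in> V" and S: "\<And>s. s \<in> S \<Longrightarrow> reach R V r s"
    and R: "\<And>a b. R a b \<Longrightarrow> dc_adj n a b" "\<And>a b. R a b \<Longrightarrow> R b a"
  shows "\<exists>T. dc_S_tree n S T \<and> fst T \<subseteq> V \<and> snd T \<subseteq> {{a, b} | a b. R a b}"
proof -
  define W where "W = {u. reach R V r u}"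
  define E where "E = {{a, b} | a b. R a b \<and> a \<in> W \<and> b \<in> W}"
  have WV: "W \<subseteq> V" using reach_end by (fastforce simp: W_def)
  then have "finite W" using V finite_dc_vertices finite_subset by metis
  moreover have "finite E"
    by (rule finite_subset[of _ "Pow W"]) (auto simp: E_def \<open>finite W\<close>)
  moreover have "graph_connected W E"
  proof -
    have from_r: "(\<lambda>a b. {a, b} \<in> E)\<^sup>*\<^sup>* r u" if "reach R V r u" for u
      using that
    proof (induction rule: reach.induct)
      case (step v w)
      have "reach R V r w" using step by (blast intro: reach.step)
      then have "{v, w} \<in> E" using step by (auto simp: E_def W_def)
      then show ?case using step.IH by (simp add: rtranclp.rtrancl_into_rtrancl)
    qed simp
    have "(\<lambda>a b. {a, b} \<in> E)\<^sup>*\<^sup>* u v" if "u \<in> W" "v \<in> W" for u v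
      using rtranclp_trans[OF edge_walk_sym[OF from_r] from_r] that by (simp add: W_def)
    moreover have "r \<in> W" using r by (simp add: W_def reach.base)
    ultimately show ?thesis by (auto simp: graph_connected_def)
  qed
  ultimately obtain E' where "E' \<subseteq> E" "is_tree W E'" using spanning_tree_exists by blast
  moreover have "E \<subseteq> dc_edges n" using R(1) by (auto simp: E_def dc_edges_def)
  moreover have "\<forall>e\<in>E. e \<subseteq> W" "E \<subseteq> {{a, b} | a b. R a b}" by (auto simp: E_def)
  moreover have "S \<subseteq> W" using S by (auto simp: W_def)
  ultimately have "dc_S_tree n S (W, E') \<and> fst (W, E') \<subseteq> V \<and> snd (W, E') \<subseteq> {{a, b} | a b. R a b}"
    using WV V by (auto simp: dc_S_tree_def)
  then show ?thesis by blast
qed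

section \<open>The dual cube in the coordinates \<open>a @ b @ [c]\<close>\<close>

lemma dc_adj_0:
  assumes "length a = m" "length b = m" "cube_adj a a'"
  shows "dc_adj (Suc m) (a @ b @ [False]) (a' @ b @ [False])"
proof -
  obtain i where i: "i < m" "a' = flip i a" using assms by (auto simp: cube_adj_def)
  then show ?thesis using assms
    by (auto simp: dc_adj_def dc_vertices_def nth_append nth_flip intro!: exI[of _ i])
qed

lemma dc_adj_1:
  assumes "length a = m" "length b = m" "cube_adj b b'"
  shows "dc_adj (Suc m) (a @ b @ [True]) (a @ b' @ [True])"
proof -
  obtain i where i: "i < m" "b' = flip i b" using assms by (auto simp: cube_adj_def)
  then show ?thesis using assms
    by (auto simp: dc_adj_def dc_vertices_def nth_append nth_flip intro!: exI[of _ "m + i"])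
qed

lemma dc_adj_cross:
  assumes "length a = m" "length b = m"
  shows "dc_adj (Suc m) (a @ b @ [c]) (a @ b @ [\<not> c])"
  using assms by (auto simp: dc_adj_def dc_vertices_def nth_append intro!: exI[of _ "2 * m"])

lemma dc_cluster_append:
  assumes "length a = m" "length b = m"
  shows "dc_cluster (Suc m) (a @ b @ [c]) = (c, if c then a else b)"
  using assms by (simp add: dc_cluster_def nth_append)

lemma dc_vertex_cases:
  assumes "u \<in> dc_vertices (Suc m)"
  obtains a b c where "u = a @ b @ [c]" "length a = m" "length b = m"
proof -
  have len: "length u = m + m + 1" using assms by (simp add: dc_vertices_def)
  have "u = take m u @ take m (drop m u) @ [u ! (m + m)]"
    using len by (metis append_take_drop_id drop_drop id_take_nth_drop take_add append.assoc
        Cons_nth_drop_Suc drop_all less_add_one Suc_eq_plus1 order_refl)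
  then show thesis using that[of "take m u" "take m (drop m u)"] len by simp
qed

text \<open>The number of vertices in \<open>S\<close> matters only through the count: after
  discarding the labels of clusters meeting \<open>S\<close>, at least \<open>m\<close> of the
  \<open>2 ^ m\<close> labels must be left for hubs.\<close>

theorem dual_cube_S_trees:
  assumes SV: "S \<subseteq> dc_vertices (Suc m)" and inj: "inj_on (dc_cluster (Suc m)) S"
    and fin: "finite S" and card: "card S + m \<le> 2 ^ m"
  shows "\<exists>T. internally_disjoint_S_trees (Suc m) S m T"
proof -
  have cluster0: "a = a'" if "a @ b @ [False] \<in> S" "a' @ b @ [False] \<in> S"
    "length a = m" "length a' = m" "length b = m" for a a' b
    using inj_onD[OF inj, of "a @ b @ [False]" "a' @ b @ [False]"] that
    by (simp add: dc_cluster_append)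
  have cluster1: "b = b'" if "a @ b @ [True] \<in> S" "a @ b' @ [True] \<in> S"
    "length a = m" "length b = m" "length b' = m" for a b b'
    using inj_onD[OF inj, of "a @ b @ [True]" "a @ b' @ [True]"] that
    by (simp add: dc_cluster_append)
  have len: "length a + length b = 2 * m" if "a @ b @ [c] \<in> S" for a b c
    using SV that by (auto simp: dc_vertices_def)
  \<comment> \<open>Labels are collected regardless of class, because each \<open>h i\<close> has to
    name a hub in both classes.\<close>
  define F where "F = snd ` dc_cluster (Suc m) ` S"
  have "finite F" "card F \<le> card S"
    using fin card_image_le[of S "dc_cluster (Suc m)"]
      card_image_le[of "dc_cluster (Suc m) ` S" snd] by (auto simp: F_def)
  then have F: "finite F" "card F + m \<le> 2 ^ m" using card by auto
  obtain h where h: "inj_on h {..<m}" "\<And>i. i < m \<Longrightarrow> length (h i) = m" "\<And>i. i < m \<Longrightarrow> h i \<notin> F"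
    using cube_vertices_avoiding[OF F] by blast
  have hub0: "a @ h i @ [False] \<notin> S" if "i < m" "length a = m" for i a
    using h(2,3)[OF that(1)] that by (force simp: F_def dc_cluster_append)
  have hub1: "h i @ b @ [True] \<notin> S" if "i < m" "length b = m" for i b
    using h(2,3)[OF that(1)] that by (force simp: F_def dc_cluster_append)
  obtain P where P: "\<And>v i. length v = m \<Longrightarrow> i < m \<Longrightarrow> P v i \<subseteq> {u. length u = m}"
    "\<And>v i. length v = m \<Longrightarrow> i < m \<Longrightarrow> reach cube_adj (P v i) v (h i)"
    "\<And>v i j. length v = m \<Longrightarrow> i < m \<Longrightarrow> j < m \<Longrightarrow> i \<noteq> j \<Longrightarrow> P v i \<inter> P v j \<subseteq> {v}"
    using cube_fan_indexed[OF h(1,2)] by blast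
  \<comment> \<open>The class 0 half of the \<open>i\<close>-th tree's territory: the hub with label
    \<open>h i\<close>, and in the cluster of each class 0 vertex of \<open>S\<close> the
    \<open>i\<close>-th set of its fan. \<open>V1\<close> is the dual.\<close>
  define V0 where "V0 i = {a @ b @ [False] | a b. length a = m \<and> length b = m \<and>
    (b = h i \<or> (\<exists>a0. length a0 = m \<and> a0 @ b @ [False] \<in> S \<and> a \<in> P a0 i))}" for i
  define V1 where "V1 i = {a @ b @ [True] | a b. length a = m \<and> length b = m \<and>
    (a = h i \<or> (\<exists>b0. length b0 = m \<and> a @ b0 @ [True] \<in> S \<and> b \<in> P b0 i))}" for i
  define V where "V i = V0 i \<union> V1 i" for i
  \<comment> \<open>Two vertices of \<open>S\<close> may be joined by a cross edge, which no tree needs.\<close>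
  define R where "R u v \<longleftrightarrow> dc_adj (Suc m) u v \<and> \<not> (u \<in> S \<and> v \<in> S)" for u v
  have R_sym: "R a b \<Longrightarrow> R b a" for a b using dc_adj_sym by (auto simp: R_def)
  \<comment> \<open>Hubs have distinct labels and miss the clusters of \<open>S\<close>, so a common
    vertex lies in two fan sets. Its cluster contains only one vertex of \<open>S\<close>, hence
    both sets belong to the same fan and meet only in its start.\<close>
  have disjoint: "V i \<inter> V j \<subseteq> S" if ij: "i < m" "j < m" "i \<noteq> j" for i j
  proof -
    have ne: "h i \<noteq> h j" using ij h(1) by (auto simp: inj_on_def)
    have "V0 i \<inter> V0 j \<subseteq> S"
    proof
      fix u assume u: "u \<in> V0 i \<inter> V0 j"
      then obtain a b where ab: "u = a @ b @ [False]" "length a = m" "length b = m"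
        "b = h i \<or> (\<exists>a0. length a0 = m \<and> a0 @ b @ [False] \<in> S \<and> a \<in> P a0 i)"
        by (auto simp: V0_def)
      moreover have "b = h j \<or> (\<exists>a0. length a0 = m \<and> a0 @ b @ [False] \<in> S \<and> a \<in> P a0 j)"
        using u ab(1-3) by (auto simp: V0_def)
      ultimately obtain a0 a1 where a0: "length a0 = m" "a0 @ b @ [False] \<in> S" "a \<in> P a0 i"
        and a1: "length a1 = m" "a1 @ b @ [False] \<in> S" "a \<in> P a1 j"
        using ne hub0 ij by blast
      then have "a0 = a1" using cluster0 ab by blast
      then have "a = a0" using P(3)[of a0 i j] a0 a1 ij by blast
      then show "u \<in> S" using a0 ab by simp
    qed
    moreover have "V1 i \<inter> V1 j \<subseteq> S"
    proof
      fix u assume u: "u \<in> V1 i \<inter> V1 j"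
      then obtain a b where ab: "u = a @ b @ [True]" "length a = m" "length b = m"
        "a = h i \<or> (\<exists>b0. length b0 = m \<and> a @ b0 @ [True] \<in> S \<and> b \<in> P b0 i)"
        by (auto simp: V1_def)
      moreover have "a = h j \<or> (\<exists>b0. length b0 = m \<and> a @ b0 @ [True] \<in> S \<and> b \<in> P b0 j)"
        using u ab(1-3) by (auto simp: V1_def)
      ultimately obtain b0 b1 where b0: "length b0 = m" "a @ b0 @ [True] \<in> S" "b \<in> P b0 i"
        and b1: "length b1 = m" "a @ b1 @ [True] \<in> S" "b \<in> P b1 j"
        using ne hub1 ij by blast
      then have "b0 = b1" using cluster1 ab by blast
      then have "b = b0" using P(3)[of b0 i j] b0 b1 ij by blast
      then show "u \<in> S" using b0 ab by simp
    qed
    moreover have "V0 i \<inter> V1 j = {}" "V1 i \<inter> V0 j = {}" by (auto simp: V0_def V1_def)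
    ultimately show ?thesis by (auto simp: V_def)
  qed
  have "\<exists>T. dc_S_tree (Suc m) S T \<and> fst T \<subseteq> V i \<and> snd T \<subseteq> {{a, b} | a b. R a b}"
    if i: "i < m" for i
  proof (rule S_tree_within)
    have hi: "length (h i) = m" using h(2) i .
    let ?r = "h i @ h i @ [False]"
    show "V i \<subseteq> dc_vertices (Suc m)" by (auto simp: V_def V0_def V1_def dc_vertices_def)
    show r: "?r \<in> V i" using hi by (auto simp: V_def V0_def)
    show "R a b \<Longrightarrow> dc_adj (Suc m) a b" "R a b \<Longrightarrow> R b a" for a b
      using R_sym by (auto simp: R_def)
    \<comment> \<open>Edges of a walk inside one cluster satisfy \<open>R\<close>, because a cluster
      contains at most one vertex of \<open>S\<close>.\<close>
    have walk0: "reach R (V i) (a @ b @ [False]) (a' @ b @ [False])"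
      if "reach cube_adj Q a a'" "length b = m" "\<And>a. a \<in> Q \<Longrightarrow> length a = m \<and> a @ b @ [False] \<in> V i"
      for a a' b Q
    proof (rule reach_map[where f = "\<lambda>a. a @ b @ [False]", OF that(1)])
      fix a a' assume "a \<in> Q" "a' \<in> Q" "cube_adj a a'"
      then show "R (a @ b @ [False]) (a' @ b @ [False])"
        unfolding R_def using dc_adj_0 cluster0 cube_adj_neq that(2,3) by metis
    qed (use that in auto)
    have walk1: "reach R (V i) (a @ b @ [True]) (a @ b' @ [True])"
      if "reach cube_adj Q b b'" "length a = m" "\<And>b. b \<in> Q \<Longrightarrow> length b = m \<and> a @ b @ [True] \<in> V i"
      for a b b' Q
    proof (rule reach_map[where f = "\<lambda>b. a @ b @ [True]", OF that(1)])
      fix b b' assume "b \<in> Q" "b' \<in> Q" "cube_adj b b'"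
      then show "R (a @ b @ [True]) (a @ b' @ [True])"
        unfolding R_def using dc_adj_1 cluster1 cube_adj_neq that(2,3) by metis
    qed (use that in auto)
    have full: "reach cube_adj {u. length u = m} a a'" if "length a = m" "length a' = m" for a a'
      using subcube_connected[of "{..<m}" a a'] subcube_all[of a] that by simp
    have in_hub0: "reach R (V i) ?r (a @ h i @ [False])" if "length a = m" for a
      using walk0[OF full[OF hi that] hi] hi by (auto simp: V_def V0_def)
    have in_hub1: "reach R (V i) (h i @ h i @ [True]) (h i @ b @ [True])" if "length b = m" for b
      using walk1[OF full[OF hi that] hi] hi by (auto simp: V_def V1_def)
    have in_V1: "h i @ b @ [True] \<in> V i" if "length b = m" for b
      using that hi by (auto simp: V_def V1_def)
    have "R ?r (h i @ h i @ [True])"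
      using dc_adj_cross[OF hi hi, of False] hub1[OF i hi] by (simp add: R_def)
    then have "reach R (V i) ?r (h i @ h i @ [True])"
      using r in_V1[OF hi] by (blast intro: reach_edge)
    then have hub1_reach: "reach R (V i) ?r (h i @ b @ [True])" if "length b = m" for b
      using in_hub1[OF that] reach_trans by metis
    fix s assume s: "s \<in> S"
    then obtain a b c where abc: "s = a @ b @ [c]" "length a = m" "length b = m"
      using dc_vertex_cases SV by blast
    show "reach R (V i) ?r s"
    proof (cases c)
      case False
      have "reach R (V i) (a @ b @ [False]) (h i @ b @ [False])"
        using walk0[OF P(2)[OF abc(2) i] abc(3)] P(1)[OF abc(2) i] s abc False
        by (auto simp: V_def V0_def)
      \<comment> \<open>This cross edge is permitted because its class 1 end lies in a hub, hence
        outside \<open>S\<close>.\<close>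
      moreover have "R (h i @ b @ [True]) (h i @ b @ [False])"
        using dc_adj_cross[OF hi abc(3), of True] hub1[OF i abc(3)] by (simp add: R_def)
      ultimately show ?thesis
        using hub1_reach[OF abc(3)] R_sym abc(1) False
        by (metis (full_types) reach.step reach_end reach_sym reach_trans)
    next
      case True
      have "reach R (V i) (a @ b @ [True]) (a @ h i @ [True])"
        using walk1[OF P(2)[OF abc(3) i] abc(2)] P(1)[OF abc(3) i] s abc True
        by (auto simp: V_def V1_def)
      moreover have "R (a @ h i @ [False]) (a @ h i @ [True])"
        using dc_adj_cross[OF abc(2) hi, of False] hub0[OF i abc(2)] by (simp add: R_def)
      ultimately show ?thesis
        using in_hub0[OF abc(2)] R_sym abc(1) True
        by (metis (full_types) reach.step reach_end reach_sym reach_trans)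
    qed
  qed
  then have "\<forall>i\<in>{..<m}. \<exists>T. dc_S_tree (Suc m) S T \<and> fst T \<subseteq> V i \<and> snd T \<subseteq> {{a, b} | a b. R a b}"
    by blast
  from bchoice[OF this] obtain T where T_all: "\<forall>i\<in>{..<m}. dc_S_tree (Suc m) S (T i) \<and>
    fst (T i) \<subseteq> V i \<and> snd (T i) \<subseteq> {{a, b} | a b. R a b}" ..
  have T: "dc_S_tree (Suc m) S (T i)" "fst (T i) \<subseteq> V i" "snd (T i) \<subseteq> {{a, b} | a b. R a b}"
    if "i < m" for i
    using bspec[OF T_all, of i] that by simp_all
  have "internally_disjoint_S_trees (Suc m) S m T"
    unfolding internally_disjoint_S_trees_def
  proof (intro conjI allI impI)
    fix i j assume ij: "i < m" "j < m" "i \<noteq> j"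
    have tree: "S \<subseteq> fst (T k)" "\<forall>e\<in>snd (T k). e \<subseteq> fst (T k)" if "k < m" for k
      using T(1)[OF that] by (simp_all add: dc_S_tree_def)
    show meet: "fst (T i) \<inter> fst (T j) = S"
      using disjoint[OF ij] T(2)[OF ij(1)] T(2)[OF ij(2)] tree(1)[OF ij(1)] tree(1)[OF ij(2)] by auto
    \<comment> \<open>Both ends of a shared edge would lie in \<open>S\<close>, and \<open>R\<close>
      forbids exactly such edges.\<close>
    show "snd (T i) \<inter> snd (T j) = {}"
    proof (rule ccontr)
      assume "snd (T i) \<inter> snd (T j) \<noteq> {}"
      then obtain e where e: "e \<in> snd (T i)" "e \<in> snd (T j)" by blast
      then have "e \<subseteq> S" using meet tree(2)[OF ij(1)] tree(2)[OF ij(2)] by auto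
      moreover obtain a b where "e = {a, b}" "R a b" using T(3)[OF ij(1)] e(1) by blast
      ultimately show False by (simp add: R_def)
    qed
  qed (rule T(1))
  then show ?thesis by blast
qed

theorem mainTheorem5:
  fixes n :: nat and x y z w :: "bool list"
  assumes "n \<ge> 4"
    and "x \<in> dc_vertices n" "y \<in> dc_vertices n" "z \<in> dc_vertices n" "w \<in> dc_vertices n"
    and "distinct [dc_cluster n x, dc_cluster n y, dc_cluster n z, dc_cluster n w]"
  shows "\<exists>T. internally_disjoint_S_trees n {x, y, z, w} (n - 1) T"
proof -
  define m where "m = n - 1"
  have n: "n = Suc m" and m: "3 \<le> m" using assms(1) by (auto simp: m_def)
  \<comment> \<open>The bound on \<open>n\<close> enters here: for \<open>m = 3\<close> this reads 7
    \<le> 8, and it fails for \<open>m = 2\<close>.\<close>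
  have "4 + m \<le> 2 ^ m" using m by (induction m rule: dec_induct) auto
  moreover have "card {x, y, z, w} \<le> 4"
    using card_length[of "[x, y, z, w]"] by simp
  ultimately have "card {x, y, z, w} + m \<le> 2 ^ m" by linarith
  moreover have "inj_on (dc_cluster n) {x, y, z, w}" using assms(6) by (auto simp: inj_on_def)
  ultimately show ?thesis
    using dual_cube_S_trees[of "{x, y, z, w}" m] assms(2-5) by (simp add: n)
qed

end
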